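(* Let $F$ be a partially total dominated forest with no isolated vertex (i.e. a finite forest with no isolated vertex together with an arbitrary set of vertices declared to be already totally dominated). Then $\gamma_{\rm tg}(F) \le \gamma_{\rm tg}'(F)$.
   Context: All graphs are finite and simple and have no isolated vertex. A vertex totally dominates another vertex if they are neighbors. A partially total dominated graph is a graph $G$ together with a declaration that the vertices of some subset $S\subseteq V(G)$ (possibly empty) are already totally dominated. The total domination game on it is played by two players, Dominator and Staller, who alternately choose vertices of $G$; each chosen vertex must be a legal move, meaning that it totally dominates (is adjacent to) at least one vertex that is not yet totally dominated, i.e. that is neither in $S$ nor adjacent to a previously chosen vertex. The game ends when all vertices of $G$ are totally dominated. Dominator wishes to minimize the number of chosen vertices, Staller wishes to maximize it. $\gamma_{\rm tg}$ (respectively $\gamma_{\rm tg}'$) denotes the number of vertices chosen under optimal play by both players when Dominator (respectively Staller) makes the first move. *)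

theory Defs
  imports "Graph_Theory.Graph_Theory"
begin

text \<open>
  Finite simple graphs are the symmetric digraphs of the locale \<open>graph\<close>: an undirected edge
  is a pair of opposite arcs. The library predicate \<open>forest\<close> cannot be used for them, because
  it counts the closed walk along an arc and back along its opposite as a cycle. Without loops
  and parallel arcs these closed walks are exactly the cycles of length 2, and the cycles
  of length at least 3 are exactly the cycles of the undirected graph.
\<close>

definition undirected_forest :: "('a,'b) pre_digraph \<Rightarrow> bool" where
  "undirected_forest G \<longleftrightarrow> graph G \<and> \<not> (\<exists>p. pre_digraph.cycle G p \<and> length p \<ge> 3)"

definition no_isolated_vertex :: "('a,'b) pre_digraph \<Rightarrow> bool" where
  "no_isolated_vertex G \<longleftrightarrow> (\<forall>v \<in> verts G. \<exists>u \<in> verts G. v \<rightarrow>\<^bsub>G\<^esub> u)"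

definition neighborhood :: "('a,'b) pre_digraph \<Rightarrow> 'a \<Rightarrow> 'a set" where
  "neighborhood G v = {u \<in> verts G. v \<rightarrow>\<^bsub>G\<^esub> u}"

text \<open>
  A position of the total domination game on \<open>G\<close> is the set \<open>S\<close> of vertices that are totally
  dominated so far, whether by initial declaration or by an earlier move.
\<close>

definition legal_moves :: "('a,'b) pre_digraph \<Rightarrow> 'a set \<Rightarrow> 'a set" where
  "legal_moves G S = {v \<in> verts G. \<exists>u \<in> neighborhood G v. u \<notin> S}"

datatype player = Dominator | Staller

fun opponent :: "player \<Rightarrow> player" where
  "opponent Dominator = Staller"
| "opponent Staller = Dominator"

fun best :: "player \<Rightarrow> nat set \<Rightarrow> nat" where
  "best Dominator = Min"
| "best Staller = Max"

text \<open>
  The number of vertices still to be chosen under optimal play when \<open>P\<close> is to move, by backward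
  induction. Without isolated vertices, there is no legal move exactly when all
  vertices are totally dominated. The test for finiteness only makes the function total.
\<close>

function game_length :: "('a,'b) pre_digraph \<Rightarrow> player \<Rightarrow> 'a set \<Rightarrow> nat" where
  "game_length G P S =
    (if finite (verts G) \<and> legal_moves G S \<noteq> {}
     then 1 + best P ((\<lambda>v. game_length G (opponent P) (S \<union> neighborhood G v)) ` legal_moves G S)
     else 0)"
  by pat_completeness auto
termination
proof (relation "measure (\<lambda>(G, P, S). card (verts G - S))")
  fix G :: "('a,'b) pre_digraph" and P :: player and S :: "'a set" and v
  assume "finite (verts G) \<and> legal_moves G S \<noteq> {}" and v: "v \<in> legal_moves G S"
  then have fin: "finite (verts G - S)" by simp
  from v have "verts G - (S \<union> neighborhood G v) \<subset> verts G - S"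
    by (auto simp: legal_moves_def neighborhood_def)
  then show "((G, opponent P, S \<union> neighborhood G v), (G, P, S))
      \<in> measure (\<lambda>(G, P, S). card (verts G - S))"
    using psubset_card_mono[OF fin] by simp
qed simp

declare game_length.simps [simp del]

definition gamma_tg :: "('a,'b) pre_digraph \<Rightarrow> 'a set \<Rightarrow> nat" where
  "gamma_tg G S = game_length G Dominator S"

definition gamma_tg' :: "('a,'b) pre_digraph \<Rightarrow> 'a set \<Rightarrow> nat" where
  "gamma_tg' G S = game_length G Staller S"

end

theory Submission
  imports Defs
begin

text \<open>
  The continuation principle (lemma \<open>continuation_principle\<close>) says that further dominated
  vertices never lengthen the game, whoever moves. This makes it possible to bound the two games
  against each other through a single position that both of them can be compared with.

  Call an undominated vertex \<open>x\<close> private at a position if choosing a neighbor of \<open>x\<close> dominates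
  \<open>x\<close> and nothing else. Such a vertex costs one move that does not interact with the
  rest of the game, so it amounts to an option to pass. In a forest every unfinished position
  is close to one with a private vertex: some undominated \<open>x\<close> has a
  neighbor \<open>w\<close> that dominates all undominated vertices that any neighbor of \<open>x\<close>
  dominates (lemma \<open>forest_greedy_neighbor\<close>; take \<open>x\<close>, \<open>w\<close> to be the first two vertices of a
  longest path that starts at an undominated vertex). If all of \<open>N(w)\<close> except \<open>x\<close> is declared
  dominated, then \<open>x\<close> becomes private.

  Write \<open>d(S)\<close> and \<open>s(S)\<close> for the lengths of the games that Dominator and Staller start at
  \<open>S\<close>, and put \<open>T = S \<union> (N(w) - {x})\<close>. Then
  \<open>d(S) \<le> 1 + s(S \<union> N(w)) = 1 + s(T \<union> {x}) \<le> s(T) \<le> s(S)\<close>,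
  where Dominator opens with \<open>w\<close>, and the last step is the continuation principle. The
  inequality in the middle says that a private vertex adds a move to the game
  (lemma \<open>private_vertex_adds_move\<close>). That holds as long as Dominator gains nothing by using
  the private vertex to pass, that is, as long as \<open>d \<le> s\<close> at all positions that contain
  \<open>T \<union> {x}\<close>. These are strictly larger than \<open>S\<close>, so \<open>d \<le> s\<close> follows by
  induction on the number of undominated vertices.
\<close>

section \<open>Optimal play\<close>

context
  fixes G :: "('a,'b) pre_digraph"
  assumes finite_verts: "finite (verts G)"
begin

lemma finite_legal_moves: "finite (legal_moves G S)"
  using finite_verts by (auto simp: legal_moves_def)

lemma game_length_no_moves: "legal_moves G S = {} \<Longrightarrow> game_length G P S = 0"
  by (simp add: game_length.simps)

lemma game_length_moves:
  assumes "legal_moves G S \<noteq> {}"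
  shows "game_length G P S =
    Suc (best P ((\<lambda>v. game_length G (opponent P) (S \<union> neighborhood G v)) ` legal_moves G S))"
  using assms finite_verts by (subst game_length.simps) simp

lemma Dominator_move:
  assumes "v \<in> legal_moves G S"
  shows "game_length G Dominator S \<le> Suc (game_length G Staller (S \<union> neighborhood G v))"
proof -
  have ne: "legal_moves G S \<noteq> {}" using assms by blast
  show ?thesis
    unfolding game_length_moves[OF ne] using assms finite_legal_moves by simp
qed

lemma Staller_move:
  assumes "v \<in> legal_moves G S"
  shows "Suc (game_length G Dominator (S \<union> neighborhood G v)) \<le> game_length G Staller S"
proof -
  have ne: "legal_moves G S \<noteq> {}" using assms by blast
  show ?thesis
    unfolding game_length_moves[OF ne] using assms finite_legal_moves by simp
qed

lemma optimal_move:
  assumes "legal_moves G S \<noteq> {}"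
  obtains v where "v \<in> legal_moves G S"
    and "game_length G P S = Suc (game_length G (opponent P) (S \<union> neighborhood G v))"
proof -
  let ?A = "(\<lambda>v. game_length G (opponent P) (S \<union> neighborhood G v)) ` legal_moves G S"
  have "finite ?A" and "?A \<noteq> {}" using assms finite_legal_moves by auto
  then have "best P ?A \<in> ?A" by (cases P) (simp_all del: image_is_empty)
  then show thesis using that game_length_moves[OF assms, of P] by force
qed

lemma undominated_decreases:
  assumes "v \<in> legal_moves G S"
  shows "card (verts G - (S \<union> neighborhood G v)) < card (verts G - S)"
proof (rule psubset_card_mono)
  show "finite (verts G - S)" using finite_verts by simp
  show "verts G - (S \<union> neighborhood G v) \<subset> verts G - S"
    using assms by (auto simp: legal_moves_def neighborhood_def)
qed

text \<open>
  The player who benefits copies an optimal move of the other position. For Staller, a move that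
  is legal at the larger position is legal at the smaller one. For Dominator, a move that is
  illegal at \<open>T\<close> dominates only vertices of \<open>T\<close>, so any legal move at \<open>T\<close>
  will do instead: the position after it contains the one after the copied move.
\<close>

lemma continuation_principle:
  assumes "S \<subseteq> T"
  shows "game_length G P T \<le> game_length G P S"
  using assms
proof (induction "card (verts G - S)" arbitrary: S T P rule: less_induct)
  case less
  have mono: "legal_moves G T \<subseteq> legal_moves G S"
    using less.prems by (auto simp: legal_moves_def)
  show ?case
  proof (cases "legal_moves G T = {}")
    case True
    then show ?thesis by (simp add: game_length_no_moves)
  next
    case False
    show ?thesis
    proof (cases P)
      case Staller
      obtain v where v: "v \<in> legal_moves G T"
        and opt: "game_length G Staller T = Suc (game_length G Dominator (T \<union> neighborhood G v))"
        using optimal_move[OF False, of Staller] by auto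
      have vS: "v \<in> legal_moves G S" using v mono by blast
      have "game_length G Dominator (T \<union> neighborhood G v)
          \<le> game_length G Dominator (S \<union> neighborhood G v)"
        using less.hyps[OF undominated_decreases[OF vS]] less.prems by blast
      then show ?thesis using opt Staller_move[OF vS] Staller by simp
    next
      case Dominator
      have "legal_moves G S \<noteq> {}" using False mono by blast
      then obtain v where v: "v \<in> legal_moves G S"
        and opt: "game_length G Dominator S = Suc (game_length G Staller (S \<union> neighborhood G v))"
        using optimal_move[of S Dominator] by auto
      obtain v' where v': "v' \<in> legal_moves G T"
        and sub: "S \<union> neighborhood G v \<subseteq> T \<union> neighborhood G v'"
      proof (cases "v \<in> legal_moves G T")
        case True
        then show thesis using that[of v] less.prems by blast
      next
        case illegal: False
        then have "neighborhood G v \<subseteq> T" using v by (auto simp: legal_moves_def)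
        then show thesis using that False less.prems by blast
      qed
      have "game_length G Staller (T \<union> neighborhood G v')
          \<le> game_length G Staller (S \<union> neighborhood G v)"
        using less.hyps[OF undominated_decreases[OF v] sub] .
      then show ?thesis using opt Dominator_move[OF v'] Dominator by simp
    qed
  qed
qed

section \<open>Private vertices\<close>

definition private_vertex :: "'a set \<Rightarrow> 'a \<Rightarrow> bool" where
  "private_vertex S x \<longleftrightarrow> x \<notin> S \<and> (\<exists>m \<in> verts G. x \<in> neighborhood G m) \<and>
    (\<forall>m \<in> verts G. x \<in> neighborhood G m \<longrightarrow> neighborhood G m \<subseteq> insert x S)"

lemma private_vertex_not_neighbor:
  assumes "private_vertex S x" and "v \<in> legal_moves G (insert x S)"
  shows "x \<notin> neighborhood G v"
  using assms by (auto simp: private_vertex_def legal_moves_def)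

lemma private_vertex_persists:
  assumes "private_vertex S x" and "x \<notin> neighborhood G v"
  shows "private_vertex (S \<union> neighborhood G v) x"
  using assms by (auto simp: private_vertex_def)

text \<open>
  Staller never touches the private vertex and plays optimally elsewhere. If Dominator
  does choose a neighbor of \<open>x\<close>, then Staller has become the first player at \<open>insert x S\<close>, and the
  assumption on Dominator's first-move advantage, which the induction below supplies, says
  that Dominator has not profited from that.
\<close>

lemma private_vertex_adds_move:
  assumes "private_vertex S x"
    and "\<And>T. insert x S \<subseteq> T \<Longrightarrow> game_length G Dominator T \<le> game_length G Staller T"
  shows "Suc (game_length G P (insert x S)) \<le> game_length G P S"
  using assms
proof (induction "card (verts G - insert x S)" arbitrary: S P rule: less_induct)
  case less
  note x = \<open>private_vertex S x\<close>
  have after_move: "Suc (game_length G Q (insert x S \<union> neighborhood G v))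
      \<le> game_length G Q (S \<union> neighborhood G v)"
    if v: "v \<in> legal_moves G (insert x S)" for v Q
  proof -
    have "private_vertex (S \<union> neighborhood G v) x"
      using private_vertex_persists[OF x private_vertex_not_neighbor[OF x v]] .
    then show ?thesis
      using less.hyps[of "S \<union> neighborhood G v" Q] undominated_decreases[OF v] less.prems(2)
      by auto
  qed
  have moves: "legal_moves G S \<noteq> {}"
    using x by (auto simp: private_vertex_def legal_moves_def)
  show ?case
  proof (cases P)
    case Staller
    show ?thesis
    proof (cases "legal_moves G (insert x S) = {}")
      case True
      then show ?thesis using game_length_moves[OF moves] game_length_no_moves[OF True] by simp
    next
      case False
      obtain v where v: "v \<in> legal_moves G (insert x S)"
        and opt: "game_length G Staller (insert x S) =
          Suc (game_length G Dominator (insert x S \<union> neighborhood G v))"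
        using optimal_move[OF False, of Staller] by auto
      have "v \<in> legal_moves G S" using v by (auto simp: legal_moves_def)
      then show ?thesis using opt after_move[OF v, of Dominator] Staller_move[of v S] Staller by simp
    qed
  next
    case Dominator
    obtain v where v: "v \<in> legal_moves G S"
      and opt: "game_length G Dominator S = Suc (game_length G Staller (S \<union> neighborhood G v))"
      using optimal_move[OF moves, of Dominator] by auto
    show ?thesis
    proof (cases "x \<in> neighborhood G v")
      case True
      then have "S \<union> neighborhood G v = insert x S"
        using x v by (auto simp: private_vertex_def legal_moves_def)
      then show ?thesis using opt less.prems(2)[of "insert x S"] Dominator by simp
    next
      case False
      then have v': "v \<in> legal_moves G (insert x S)" using v by (auto simp: legal_moves_def)
      then show ?thesis
        using opt after_move[OF v', of Staller] Dominator_move[OF v'] Dominator by simp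
    qed
  qed
qed

text \<open>
  The graph enters through the existence of a greedy neighbor at every unfinished position.
  Dominator opens with that neighbor \<open>w\<close>; for Staller, all of \<open>N(w)\<close> except \<open>x\<close> is
  given away for free, which makes \<open>x\<close> private.
\<close>

lemma Dominator_first_le_Staller_first:
  assumes greedy: "\<And>S. legal_moves G S \<noteq> {} \<Longrightarrow>
    \<exists>x w. x \<notin> S \<and> w \<in> verts G \<and> x \<in> neighborhood G w \<and>
      (\<forall>m \<in> verts G. x \<in> neighborhood G m \<longrightarrow> neighborhood G m \<subseteq> S \<union> neighborhood G w)"
  shows "game_length G Dominator S \<le> game_length G Staller S"
proof (induction "card (verts G - S)" arbitrary: S rule: less_induct)
  case less
  show ?case
  proof (cases "legal_moves G S = {}")
    case True
    then show ?thesis by (simp add: game_length_no_moves)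
  next
    case False
    then obtain x w where xw: "x \<notin> S" "w \<in> verts G" "x \<in> neighborhood G w"
      and greedy_w: "\<And>m. m \<in> verts G \<Longrightarrow> x \<in> neighborhood G m \<Longrightarrow>
        neighborhood G m \<subseteq> S \<union> neighborhood G w"
      using greedy by meson
    define T where "T = S \<union> (neighborhood G w - {x})"
    have w: "w \<in> legal_moves G S" using xw by (auto simp: legal_moves_def)
    have T: "insert x T = S \<union> neighborhood G w" using xw by (auto simp: T_def)
    have "private_vertex T x"
      unfolding private_vertex_def T using xw greedy_w by (auto simp: T_def)
    moreover have "game_length G Dominator U \<le> game_length G Staller U" if "insert x T \<subseteq> U" for U
    proof (rule less.hyps)
      have "card (verts G - U) \<le> card (verts G - (S \<union> neighborhood G w))"
        using that T finite_verts by (intro card_mono) auto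
      then show "card (verts G - U) < card (verts G - S)"
        using undominated_decreases[OF w] by simp
    qed
    ultimately have "Suc (game_length G Staller (S \<union> neighborhood G w)) \<le> game_length G Staller T"
      using private_vertex_adds_move[of T x Staller] T by simp
    also have "\<dots> \<le> game_length G Staller S"
      by (rule continuation_principle) (simp add: T_def)
    finally show ?thesis using Dominator_move[OF w] by simp
  qed
qed

end

section \<open>Longest paths in forests\<close>

text \<open>Otherwise the arc closes a cycle of length at least 3.\<close>

lemma forest_neighbor_on_path:
  assumes "undirected_forest G"
    and path: "pre_digraph.apath G u p v"
    and e: "e \<in> arcs G" "head G e = u"
    and on_path: "tail G e \<in> set (pre_digraph.awalk_verts G u p)"
  shows "p \<noteq> [] \<and> tail G e = head G (hd p)"
proof -
  interpret graph G using assms(1) by (simp add: undirected_forest_def)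
  have no_cycle: "length c < 3" if "cycle c" for c
    using assms(1) that by (force simp: undirected_forest_def)
  obtain q r where pqr: "p = q @ r" and q: "awalk u q (tail G e)"
    using path on_path awalk_decomp[of u p v "tail G e"] by (auto simp: apath_def)
  have "distinct (awalk_verts u q)"
    using path apath_append_iff[of u q r v] by (simp add: pqr apath_def)
  then have "cycle (e # q)"
    unfolding cycle_def using q e by (auto simp: awalk_Cons_iff intro!: exI[of _ "tail G e"])
  then have "length q \<le> 1" using no_cycle[of "e # q"] by simp
  moreover have "q \<noteq> []" using q e no_loops[of e] by (auto simp: awalk_Nil_iff)
  ultimately obtain f where "q = [f]" by (cases q) auto
  then show ?thesis using q pqr by (auto simp: awalk_simps)
qed

text \<open>
  Let \<open>x\<close>, \<open>w\<close> be the first two vertices of a longest path among those that start at an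
  undominated vertex. If another neighbor \<open>m\<close> of \<open>x\<close> had an undominated neighbor
  \<open>y\<close> other than \<open>x\<close>, then \<open>y\<close>, \<open>m\<close> could be put before \<open>x\<close>. So all neighbors of \<open>x\<close> but \<open>w\<close>
  dominate nothing new besides \<open>x\<close>.
\<close>

lemma forest_greedy_neighbor:
  assumes forest: "undirected_forest G" and "legal_moves G S \<noteq> {}"
  shows "\<exists>x w. x \<notin> S \<and> w \<in> verts G \<and> x \<in> neighborhood G w \<and>
    (\<forall>m \<in> verts G. x \<in> neighborhood G m \<longrightarrow> neighborhood G m \<subseteq> S \<union> neighborhood G w)"
proof -
  interpret graph G using forest by (simp add: undirected_forest_def)
  have arc: "\<exists>e \<in> arcs G. tail G e = a \<and> head G e = b" if "b \<in> neighborhood G a" for a b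
    using that by (auto simp: neighborhood_def arcs_ends_def arc_to_ends_def)
  have sym_nb: "a \<in> neighborhood G b" if "b \<in> neighborhood G a" for a b
    using that graph_symmetric[of a b] by (auto simp: neighborhood_def adj_in_verts)
  have head_nb: "head G e \<in> neighborhood G (tail G e)" if "e \<in> arcs G" for e
    using that by (auto simp: neighborhood_def arcs_ends_def arc_to_ends_def)
  define good where "good p \<longleftrightarrow> (\<exists>u v. u \<notin> S \<and> p \<noteq> [] \<and> apath u p v)" for p
  have bounded: "length p < card (verts G)" if "good p" for p
    using that by (auto simp: good_def intro: length_apath_less)
  obtain w\<^sub>0 x\<^sub>0 where x0: "x\<^sub>0 \<in> neighborhood G w\<^sub>0" "x\<^sub>0 \<notin> S"
    using assms(2) by (auto simp: legal_moves_def)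
  obtain e\<^sub>0 where e0: "e\<^sub>0 \<in> arcs G" "tail G e\<^sub>0 = x\<^sub>0" "head G e\<^sub>0 = w\<^sub>0"
    using arc[OF sym_nb[OF x0(1)]] by auto
  have "apath x\<^sub>0 [e\<^sub>0] w\<^sub>0"
    using e0 no_loops[of e\<^sub>0] by (auto simp: apath_simps)
  then have "good [e\<^sub>0]" using x0 by (auto simp: good_def)
  then have "\<exists>p. good p \<and> (\<forall>q. good q \<longrightarrow> length q \<le> length p)"
    by (rule ex_has_greatest_nat[where b = "card (verts G)"]) (simp add: bounded)
  then obtain p where "good p" and longest: "\<And>q. good q \<Longrightarrow> length q \<le> length p"
    by blast
  then obtain x v where x: "x \<notin> S" and path: "apath x p v" and "p \<noteq> []"
    by (auto simp: good_def)
  then obtain f p' where p: "p = f # p'" by (cases p) auto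
  define w where "w = head G f"
  have f: "f \<in> arcs G" "tail G f = x" using path p by (auto simp: apath_Cons_iff)
  have wx: "w \<in> neighborhood G x" using head_nb[OF f(1)] f(2) w_def by simp
  have xw: "w \<in> verts G" "x \<in> neighborhood G w"
    using wx sym_nb[OF wx] by (simp_all add: neighborhood_def)
  have "y \<in> S \<union> neighborhood G w"
    if m: "x \<in> neighborhood G m" and y: "y \<in> neighborhood G m" for m y
  proof (rule ccontr)
    assume no: "y \<notin> S \<union> neighborhood G w"
    obtain e where e: "e \<in> arcs G" "tail G e = m" "head G e = x" using arc[OF m] by auto
    obtain d where d: "d \<in> arcs G" "tail G d = y" "head G d = m" using arc[OF sym_nb[OF y]] by auto
    have "m \<noteq> w" using no y by blast
    then have "m \<notin> set (awalk_verts x p)"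
      using forest_neighbor_on_path[OF forest path e(1,3)] e p w_def by auto
    then have path': "apath m (e # p) v" using e path by (simp add: apath_Cons_iff)
    have "y \<noteq> x" using no xw by blast
    then have "y \<notin> set (awalk_verts m (e # p))"
      using forest_neighbor_on_path[OF forest path' d(1,3)] d e by auto
    then have "apath y (d # e # p) v"
      using d path' apath_Cons_iff[of y d "e # p" v] by simp
    then have "good (d # e # p)" using no by (auto simp: good_def)
    then have "length (d # e # p) \<le> length p" by (rule longest)
    then show False by simp
  qed
  then show ?thesis using x xw by blast
qed

theorem theorem1:
  fixes F :: "('a,'b) pre_digraph" and S :: "'a set"
  assumes "undirected_forest F"
    and "no_isolated_vertex F"
    and "S \<subseteq> verts F"
  shows "gamma_tg F S \<le> gamma_tg' F S"
proof -
  interpret graph F using assms(1) by (simp add: undirected_forest_def)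
  show ?thesis
    unfolding gamma_tg_def gamma_tg'_def
    by (rule Dominator_first_le_Staller_first[OF finite_verts forest_greedy_neighbor[OF assms(1)]])
qed

end
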